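(* The set of prime candidates $\widetilde{P}$ (a set containing every prime number) can be written as $$\widetilde{P}=(\mathbb{N}\cap\{2\})\cup(\mathbb{N}\cap\{3\})\cup\bigl(\mathbb{N}\setminus(\{1\}\cup TWO\cup THREE\cup FOUR\cup SIX)\bigr)=\{2\}\cup\{3\}\cup A\cup B.$$ That is, the two displayed sets are equal and every prime number belongs to them.
   Context: $\mathbb{N}=\{1,2,3,\dots\}$. Define $TWO=\{6k-4:k\in\mathbb{N}\}$, $THREE=\{6k-3:k\in\mathbb{N}\}$, $FOUR=\{6k-2:k\in\mathbb{N}\}$, $A=\{6k-1:k\in\mathbb{N}\}$, $SIX=\{6k:k\in\mathbb{N}\}$, $B=\{6k+1:k\in\mathbb{N}\}$. *)

theory Defs
  imports "HOL-Computational_Algebra.Primes"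
begin

(* The natural numbers here start at 1, unlike the type nat. *)
definition pos_nats :: "nat set" where
  "pos_nats = {n. 1 \<le> n}"

(* Since k \<ge> 1 gives 6 * k \<ge> 6, the truncated subtraction of nat is exact below. *)

definition TWO :: "nat set" where
  "TWO = {6 * k - 4 | k. k \<in> pos_nats}"

definition THREE :: "nat set" where
  "THREE = {6 * k - 3 | k. k \<in> pos_nats}"

definition FOUR :: "nat set" where
  "FOUR = {6 * k - 2 | k. k \<in> pos_nats}"

definition A_set :: "nat set" where
  "A_set = {6 * k - 1 | k. k \<in> pos_nats}"

definition SIX :: "nat set" where
  "SIX = {6 * k | k. k \<in> pos_nats}"

definition B_set :: "nat set" where
  "B_set = {6 * k + 1 | k. k \<in> pos_nats}"

definition prime_candidates :: "nat set" where
  "prime_candidates =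
     (pos_nats \<inter> {2}) \<union> (pos_nats \<inter> {3})
       \<union> (pos_nats - ({1} \<union> TWO \<union> THREE \<union> FOUR \<union> SIX))"

end

theory Submission
  imports Defs
begin

text \<open>
  Each of the six progressions is a residue class modulo 6, cut down to the positive integers
  and, for \<^const>\<open>B_set\<close>, without the number 1. So an integer greater than 1 that avoids the
  residues 0, 2, 3, 4 has residue 5 or 1 and lies in \<^const>\<open>A_set\<close> or \<^const>\<open>B_set\<close>; removing 1
  compensates exactly for \<^const>\<open>B_set\<close> starting at 7. A prime other than 2 and 3 is divisible by
  neither of them, which rules out the residues 0, 2, 4 and 0, 3 respectively.
\<close>

lemma TWO_iff: "n \<in> TWO \<longleftrightarrow> n mod 6 = 2"
  unfolding TWO_def pos_nats_def mem_Collect_eq by presburger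

lemma THREE_iff: "n \<in> THREE \<longleftrightarrow> n mod 6 = 3"
  unfolding THREE_def pos_nats_def mem_Collect_eq by presburger

lemma FOUR_iff: "n \<in> FOUR \<longleftrightarrow> n mod 6 = 4"
  unfolding FOUR_def pos_nats_def mem_Collect_eq by presburger

lemma A_set_iff: "n \<in> A_set \<longleftrightarrow> n mod 6 = 5"
  unfolding A_set_def pos_nats_def mem_Collect_eq by presburger

lemma SIX_iff: "n \<in> SIX \<longleftrightarrow> n mod 6 = 0 \<and> n \<noteq> 0"
  unfolding SIX_def pos_nats_def mem_Collect_eq by presburger

lemma B_set_iff: "n \<in> B_set \<longleftrightarrow> n mod 6 = 1 \<and> n \<noteq> 1"
  unfolding B_set_def pos_nats_def mem_Collect_eq by presburger

lemma prime_mod_6: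
  fixes p :: nat
  assumes "prime p" "p \<noteq> 2" "p \<noteq> 3"
  shows "p mod 6 = 1 \<or> p mod 6 = 5"
proof -
  have "\<not> 2 dvd p" "\<not> 3 dvd p"
    using assms primes_dvd_imp_eq[of 2 p] primes_dvd_imp_eq[of 3 p] by auto
  then show ?thesis by presburger
qed

theorem theorem1:
  shows "prime_candidates = {2} \<union> {3} \<union> A_set \<union> B_set
       \<and> (\<forall>p::nat. prime p \<longrightarrow> p \<in> prime_candidates)"
proof -
  have eq: "prime_candidates = {2} \<union> {3} \<union> A_set \<union> B_set"
  proof (rule set_eqI)
    fix n
    have "n \<in> prime_candidates \<longleftrightarrow> n = 2 \<or> n = 3 \<or>
        1 \<le> n \<and> \<not> (n = 1 \<or> n mod 6 = 2 \<or> n mod 6 = 3 \<or> n mod 6 = 4 \<or> n mod 6 = 0 \<and> n \<noteq> 0)"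
      by (auto simp: prime_candidates_def pos_nats_def TWO_iff THREE_iff FOUR_iff SIX_iff)
    also have "\<dots> \<longleftrightarrow> n = 2 \<or> n = 3 \<or> n mod 6 = 5 \<or> n mod 6 = 1 \<and> n \<noteq> 1"
      by presburger
    also have "\<dots> \<longleftrightarrow> n \<in> {2} \<union> {3} \<union> A_set \<union> B_set"
      by (auto simp: A_set_iff B_set_iff)
    finally show "n \<in> prime_candidates \<longleftrightarrow> n \<in> {2} \<union> {3} \<union> A_set \<union> B_set" .
  qed
  moreover have "p \<in> {2} \<union> {3} \<union> A_set \<union> B_set" if "prime p" for p :: nat
    using prime_mod_6[OF that] prime_gt_1_nat[OF that] by (auto simp: A_set_iff B_set_iff)
  ultimately show ?thesis by simp
qed

end
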